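(* Let $G$ be a $5/2$-closed transitive permutation group with a normal block system $\mathcal{B}$, and let $\mathcal{E}$ be the $\mathcal{B}$-fixer block system of $G$. Suppose that whenever $H\le G$ is a transitive subgroup and $\mathcal{C}$ is a normal block system of $H$ with $\mathcal{B}\preceq\mathcal{C}$, the block system $\mathcal{E}_{\mathcal{C}}$ induced by the $\mathcal{C}/\mathcal{B}$-fixer block system $\mathcal{E}_{\mathcal{C}}/\mathcal{B}$ of $H/\mathcal{B}$ satisfies $\mathcal{E}\preceq\mathcal{E}_{\mathcal{C}}$. Then $G/\mathcal{B}$ is $5/2$-closed.
   Context: All permutation groups act on finite sets. Let $G\le S_X$ be transitive. A block of $G$ is a subset $B\subseteq X$ such that $g(B)\cap B\in\{\emptyset,B\}$ for all $g\in G$; the set $\{g(B):g\in G\}$ for a (nonempty) block $B$ is a block system of $G$ (trivial cases, singletons and $\{X\}$, are allowed). A block system is normal if it is the set of orbits of some normal subgroup of $G$. For a block system $\mathcal{B}$, $\mathrm{fix}_G(\mathcal{B})=\{g\in G: g(B)=B \text{ for all } B\in\mathcal{B}\}$. If $K\le S_X$ leaves $Y\subseteq X$ invariant, $K^Y$ is the permutation group induced by $K$ on $Y$ (and $K^Y=1$ means $K$ fixes every point of $Y$). Quotients: $G/\mathcal{B}$ is the permutation group induced by $G$ on the set $\mathcal{B}$, and $g/\mathcal{B}$ is the permutation induced by $g\in G$; for a subgroup $H\le G$, $H/\mathcal{B}$ is the permutation group induced by $H$ on $\mathcal{B}$. Write $\mathcal{B}\preceq\mathcal{C}$ ("$\mathcal{B}$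 refines $\mathcal{C}$") if each block of $\mathcal{B}$ is contained in a block of $\mathcal{C}$. If $\mathcal{B}\preceq\mathcal{C}$, then $C/\mathcal{B}=\{B\in\mathcal{B}:B\subseteq C\}$ for $C\in\mathcal{C}$ and $\mathcal{C}/\mathcal{B}=\{C/\mathcal{B}:C\in\mathcal{C}\}$. Conversely, a block system of $G/\mathcal{B}$ (or of $H/\mathcal{B}$) is written $\mathcal{D}/\mathcal{B}$, where $\mathcal{D}$, the block system it induces, is the set of unions of the blocks of $\mathcal{B}$ contained in each of its blocks. Wreath stabilizer: for $\mathcal{B}$ a normal block system of $G$ and $B\in\mathcal{B}$, $\mathrm{WStab}_G(B)$ is the largest subgroup $K\le\mathrm{fix}_G(\mathcal{B})$ such that $K^B=1$ and, for every $B'\in\mathcal{B}$, $K^{B'}$ is trivial or transitive on $B'$ (it is the group generated by all subgroups with this property). Define $B\equiv B'$ on $\mathcal{B}$ iff $\mathrm{WStab}_G(B)=\mathrm{WStab}_G(B')$. The $\mathcal{B}$-fixer block system of $G$ is the set of subsets of $X$ that are unions of the blocks in an equivalence class of $\equiv$; it is a block system of $G$ refined by $\mathcal{B}$. For $g\in S_X$ and $Y\subseteq X$ with $g(Y)=Y$, $g|_Y\in S_X$ is the permutation equal to $g$ on $Y$ and to the identity off $Y$. A transitive group $G\le S_X$ is $5/2$-closed if for every transitive subgroup $H\le G$, every normal block system $\mathcal{B}_H$ of $H$, every block $E$ of the $\mathcal{B}_H$-fixer block system of $H$, and every $g\in G$ that fixes setwise each block of $\mathcal{B}_H$ contained in $E$,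 one has $g|_E\in G$. *)

theory Defs
  imports "HOL-Algebra.Group_Action" "HOL-Algebra.Generated_Groups"
begin

text \<open>
  The symmetric group \<open>S\<^sub>X\<close> is \<^const>\<open>BijGroup\<close>: its elements are the bijections of \<open>X\<close>
  onto itself, extended by \<^const>\<open>undefined\<close> outside \<open>X\<close>.  A permutation group is a
  subgroup of it, given by its carrier.
\<close>

abbreviation perm_monoid :: "'a set \<Rightarrow> ('a \<Rightarrow> 'a) set \<Rightarrow> ('a \<Rightarrow> 'a) monoid" where
  "perm_monoid X G \<equiv> (BijGroup X)\<lparr>carrier := G\<rparr>"

definition transitive_perm_group :: "'a set \<Rightarrow> ('a \<Rightarrow> 'a) set \<Rightarrow> bool" where
  "transitive_perm_group X G \<longleftrightarrow>
     finite X \<and> subgroup G (BijGroup X) \<and> transitive_action (perm_monoid X G) X (\<lambda>g. g)"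

definition block :: "'a set \<Rightarrow> ('a \<Rightarrow> 'a) set \<Rightarrow> 'a set \<Rightarrow> bool" where
  "block X G B \<longleftrightarrow> B \<subseteq> X \<and> (\<forall>g\<in>G. g ` B \<inter> B \<in> {{}, B})"

definition block_system :: "'a set \<Rightarrow> ('a \<Rightarrow> 'a) set \<Rightarrow> 'a set set \<Rightarrow> bool" where
  "block_system X G \<B> \<longleftrightarrow> (\<exists>B. block X G B \<and> B \<noteq> {} \<and> \<B> = {g ` B | g. g \<in> G})"

definition normal_block_system :: "'a set \<Rightarrow> ('a \<Rightarrow> 'a) set \<Rightarrow> 'a set set \<Rightarrow> bool" where
  "normal_block_system X G \<B> \<longleftrightarrow>
     block_system X G \<B> \<and>
     (\<exists>N. N \<lhd> perm_monoid X G \<and> \<B> = orbits (perm_monoid X N) X (\<lambda>g. g))"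

definition refines :: "'a set set \<Rightarrow> 'a set set \<Rightarrow> bool" where
  "refines \<B> \<C> \<longleftrightarrow> (\<forall>B\<in>\<B>. \<exists>C\<in>\<C>. B \<subseteq> C)"

definition block_fixer :: "('a \<Rightarrow> 'a) set \<Rightarrow> 'a set set \<Rightarrow> ('a \<Rightarrow> 'a) set" where
  "block_fixer G \<B> = {g \<in> G. \<forall>B\<in>\<B>. g ` B = B}"

text \<open>The group \<open>K\<^sup>Y\<close> induced on an invariant subset \<open>Y\<close>, as a subset of \<open>BijGroup Y\<close>.\<close>

definition induced_group :: "('a \<Rightarrow> 'a) set \<Rightarrow> 'a set \<Rightarrow> ('a \<Rightarrow> 'a) set" where
  "induced_group K Y = (\<lambda>k. restrict k Y) ` K"

definition trivial_on :: "('a \<Rightarrow> 'a) set \<Rightarrow> 'a set \<Rightarrow> bool" where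
  "trivial_on K Y \<longleftrightarrow> induced_group K Y = {\<one>\<^bsub>BijGroup Y\<^esub>}"

definition wstab_candidate ::
  "'a set \<Rightarrow> ('a \<Rightarrow> 'a) set \<Rightarrow> 'a set set \<Rightarrow> 'a set \<Rightarrow> ('a \<Rightarrow> 'a) set \<Rightarrow> bool" where
  "wstab_candidate X G \<B> B K \<longleftrightarrow>
     subgroup K (BijGroup X) \<and> K \<subseteq> block_fixer G \<B> \<and> trivial_on K B \<and>
     (\<forall>B'\<in>\<B>. trivial_on K B' \<or> transitive_perm_group B' (induced_group K B'))"

text \<open>
  The candidates for a given \<open>B \<in> \<B>\<close> have a largest element, namely the group they
  generate: on each block it is transitive if some candidate is, and trivial otherwise.
\<close>

definition wstab ::
  "'a set \<Rightarrow> ('a \<Rightarrow> 'a) set \<Rightarrow> 'a set set \<Rightarrow> 'a set \<Rightarrow> ('a \<Rightarrow> 'a) set" where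
  "wstab X G \<B> B = generate (BijGroup X) (\<Union>{K. wstab_candidate X G \<B> B K})"

definition fixer_block_system ::
  "'a set \<Rightarrow> ('a \<Rightarrow> 'a) set \<Rightarrow> 'a set set \<Rightarrow> 'a set set" where
  "fixer_block_system X G \<B> =
     {\<Union>{B' \<in> \<B>. wstab X G \<B> B = wstab X G \<B> B'} | B. B \<in> \<B>}"

text \<open>\<open>g|\<^sub>Y\<close> as an element of \<open>S\<^sub>X\<close> (so not the library's \<^const>\<open>restrict\<close>).\<close>

definition perm_restrict :: "'a set \<Rightarrow> ('a \<Rightarrow> 'a) \<Rightarrow> 'a set \<Rightarrow> ('a \<Rightarrow> 'a)" where
  "perm_restrict X g Y = (\<lambda>x\<in>X. if x \<in> Y then g x else x)"

definition five_halves_closed :: "'a set \<Rightarrow> ('a \<Rightarrow> 'a) set \<Rightarrow> bool" where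
  "five_halves_closed X G \<longleftrightarrow>
     transitive_perm_group X G \<and>
     (\<forall>H \<B> E g. transitive_perm_group X H \<and> H \<subseteq> G \<and>
        normal_block_system X H \<B> \<and> E \<in> fixer_block_system X H \<B> \<and>
        g \<in> G \<and> (\<forall>B\<in>\<B>. B \<subseteq> E \<longrightarrow> g ` B = B)
        \<longrightarrow> perm_restrict X g E \<in> G)"

text \<open>\<open>G/\<B>\<close>, a permutation group on the set \<open>\<B>\<close>.\<close>

definition quotient_perm :: "'a set set \<Rightarrow> ('a \<Rightarrow> 'a) \<Rightarrow> ('a set \<Rightarrow> 'a set)" where
  "quotient_perm \<B> g = (\<lambda>B\<in>\<B>. g ` B)"

definition quotient_group :: "('a \<Rightarrow> 'a) set \<Rightarrow> 'a set set \<Rightarrow> ('a set \<Rightarrow> 'a set) set" where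
  "quotient_group G \<B> = quotient_perm \<B> ` G"

definition quotient_system :: "'a set set \<Rightarrow> 'a set set \<Rightarrow> 'a set set set" where
  "quotient_system \<C> \<B> = {{B \<in> \<B>. B \<subseteq> C} | C. C \<in> \<C>}"

text \<open>The block system \<open>\<D>\<close> induced by a block system \<open>\<D>/\<B>\<close> of \<open>G/\<B>\<close>.\<close>

definition unquotient_system :: "'a set set set \<Rightarrow> 'a set set" where
  "unquotient_system \<Q> = {\<Union>Q | Q. Q \<in> \<Q>}"


end

theory Submission
  imports "HOL-Library.Disjoint_Sets" "HOL-Algebra.Multiplicative_Group" Defs
begin

text \<open>
  A transitive subgroup \<open>H\<close> of \<open>G/\<B>\<close> with a normal block system \<open>\<C>\<close> lifts to its preimage \<open>P\<close> in
  \<open>G\<close>.  The group \<open>P\<close> is transitive because it permutes the blocks of \<open>\<B>\<close> as \<open>H\<close> does and contains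
  the fixer of \<open>\<B>\<close>, which is transitive on each block.  The unions of the members of \<open>\<C>\<close> form a normal block system of \<open>P\<close>: a normal subgroup
  with orbits \<open>\<C>\<close> has a normal preimage, whose orbits are these unions.

  The point of the proof is that unions of members of \<open>\<C>\<close> with equal wreath stabilizers in \<open>P\<close> come
  from members with equal wreath stabilizers in \<open>H\<close> (\<open>wstab_eq_quotient\<close>).  Let \<open>K \<le> H\<close> be one of the
  groups that generate the wreath stabilizer of \<open>C \<in> \<C>\<close>.  The hypothesis on \<open>\<E>\<close> makes the union \<open>Y\<close>
  of all blocks in the members of \<open>\<C>\<close> on which \<open>K\<close> is trivial a union of blocks of \<open>\<E>\<close>.  Since \<open>G\<close> is
  5/2-closed, each \<open>k\<close> in the preimage of \<open>K\<close> has \<open>k|\<^sub>Y \<in> G\<close>, and so \<open>k\<close> can be replaced by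
  \<open>k (k|\<^sub>Y)\<^sup>-\<^sup>1\<close>, which fixes \<open>Y\<close> pointwise and agrees with \<open>k\<close> elsewhere.  The elements of the
  preimage that fix \<open>Y\<close> pointwise thus form a subgroup of the wreath stabilizer of \<open>\<Union>C\<close> in \<open>P\<close>, and
  they still induce \<open>K\<close> on \<open>\<B>\<close> (\<open>candidate_trivial_on_equivalent_block\<close>).

  It follows that each block \<open>F\<close> of the fixer block system of \<open>H\<close> is, as a set of points, a union of
  blocks of the fixer block system of \<open>P\<close>.  If \<open>g \<in> G\<close> induces an element that fixes the members of
  \<open>\<C>\<close> within \<open>F\<close>, then the product of the restrictions of \<open>g\<close> to these blocks is in \<open>G\<close>, and it
  induces the required restriction to \<open>F\<close> (\<open>perm_restrict_quotient\<close>).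

  Throughout, \<open>refines\<close> is the relation between block systems that occurs in the theorem, not the
  relation of the same name in \<^theory>\<open>HOL-Library.Disjoint_Sets\<close>.
\<close>

section \<open>Permutation groups by their elements\<close>

lemma BijGroup_simps:
  "carrier (BijGroup X) = Bij X" "\<one>\<^bsub>BijGroup X\<^esub> = (\<lambda>x\<in>X. x)"
  "\<lbrakk>f \<in> Bij X; g \<in> Bij X\<rbrakk> \<Longrightarrow> f \<otimes>\<^bsub>BijGroup X\<^esub> g = compose X f g"
  by (simp_all add: BijGroup_def)

lemma BijD:
  assumes "g \<in> Bij X"
  shows "g ` X = X" "inj_on g X"
  using assms by (auto simp: Bij_def bij_betw_def)

lemma Bij_eqI: "\<lbrakk>f \<in> Bij X; g \<in> Bij X; \<And>x. x \<in> X \<Longrightarrow> f x = g x\<rbrakk> \<Longrightarrow> f = g"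
  by (auto simp: Bij_def intro: extensionalityI)

lemma finite_Bij:
  assumes "finite X" shows "finite (Bij X)"
proof -
  have "Bij X \<subseteq> (X \<rightarrow>\<^sub>E X)"
    by (auto simp: Bij_def PiE_def bij_betw_def)
  then show ?thesis
    using assms finite_PiE finite_subset by meson
qed

lemma image_compose_subset: "A \<subseteq> X \<Longrightarrow> compose X f g ` A = f ` g ` A"
  unfolding image_image by (intro image_cong refl compose_eq) auto

lemma subgroup_BijGroupD:
  assumes "subgroup G (BijGroup X)"
  shows "G \<subseteq> Bij X" "(\<lambda>x\<in>X. x) \<in> G"
    and "\<And>f g. \<lbrakk>f \<in> G; g \<in> G\<rbrakk> \<Longrightarrow> compose X f g \<in> G"
proof -
  show sub: "G \<subseteq> Bij X" using subgroup.subset[OF assms] by (simp add: BijGroup_simps)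
  show "(\<lambda>x\<in>X. x) \<in> G" using subgroup.one_closed[OF assms] by (simp add: BijGroup_simps)
  fix f g assume "f \<in> G" "g \<in> G"
  moreover from this have "f \<in> Bij X" "g \<in> Bij X" using sub by auto
  ultimately show "compose X f g \<in> G"
    using subgroup.m_closed[OF assms, of f g] by (simp add: BijGroup_simps)
qed

lemma subgroup_BijGroup_inverse:
  assumes "subgroup G (BijGroup X)" "g \<in> G"
  obtains h where "h \<in> G" "\<And>x. x \<in> X \<Longrightarrow> h (g x) = x" "\<And>x. x \<in> X \<Longrightarrow> g (h x) = x"
proof -
  interpret group "BijGroup X" by (rule group_BijGroup)
  let ?h = "inv\<^bsub>BijGroup X\<^esub> g"
  have g: "g \<in> Bij X" using assms subgroup_BijGroupD(1) by blast
  have hG: "?h \<in> G" using assms by (rule subgroup.m_inv_closed)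
  then have h: "?h \<in> Bij X" using assms subgroup_BijGroupD(1) by blast
  have "compose X ?h g = (\<lambda>x\<in>X. x)" "compose X g ?h = (\<lambda>x\<in>X. x)"
    using l_inv[of g] r_inv[of g] g h by (simp_all add: BijGroup_simps)
  then show ?thesis
    by (intro that[OF hG]) (metis compose_eq restrict_apply')+
qed

text \<open>In a finite group, inverses are powers, so closure under composition is enough.\<close>

lemma subgroup_BijGroupI:
  assumes "finite X" "G \<subseteq> Bij X" "(\<lambda>x\<in>X. x) \<in> G"
    and mult: "\<And>f g. \<lbrakk>f \<in> G; g \<in> G\<rbrakk> \<Longrightarrow> compose X f g \<in> G"
  shows "subgroup G (BijGroup X)"
proof -
  interpret group "BijGroup X" by (rule group_BijGroup)
  have fin: "finite (carrier (BijGroup X))"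
    using finite_Bij[OF assms(1)] by (simp add: BijGroup_simps)
  have m: "f \<otimes>\<^bsub>BijGroup X\<^esub> g \<in> G" if "f \<in> G" "g \<in> G" for f g
  proof -
    have "f \<in> Bij X" "g \<in> Bij X" using that assms(2) by auto
    then show ?thesis using mult[OF that] by (simp add: BijGroup_simps)
  qed
  have pow: "f [^]\<^bsub>BijGroup X\<^esub> (n::nat) \<in> G" if "f \<in> G" for f n
  proof (induction n)
    case 0
    show ?case unfolding nat_pow_0 BijGroup_simps(2) by (rule assms(3))
  next
    case (Suc n)
    then show ?case using m that by simp
  qed
  have inv: "inv\<^bsub>BijGroup X\<^esub> f \<in> G" if "f \<in> G" for f
  proof -
    have fc: "f \<in> carrier (BijGroup X)" using that assms(2) by (auto simp: BijGroup_simps)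
    have "order (BijGroup X) > 0" using fin by (simp add: order_gt_0_iff_finite)
    then obtain n where n: "order (BijGroup X) = Suc n" by (metis gr0_conv_Suc)
    have "f [^]\<^bsub>BijGroup X\<^esub> n \<otimes>\<^bsub>BijGroup X\<^esub> f = \<one>\<^bsub>BijGroup X\<^esub>"
      using pow_order_eq_1[OF fc] by (simp add: n)
    then have "inv\<^bsub>BijGroup X\<^esub> f = f [^]\<^bsub>BijGroup X\<^esub> n"
      using fc by (intro inv_equality) auto
    then show ?thesis using pow[OF that] by simp
  qed
  show ?thesis
    by (rule subgroupI) (use assms(2,3) inv m in \<open>auto simp: BijGroup_simps\<close>)
qed

lemma transitive_perm_group_iff:
  "transitive_perm_group X G \<longleftrightarrow>
     finite X \<and> subgroup G (BijGroup X) \<and> (\<forall>x\<in>X. \<forall>y\<in>X. \<exists>g\<in>G. g x = y)"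
proof -
  have "group_action (perm_monoid X G) X (\<lambda>g. g)" if "subgroup G (BijGroup X)"
    using group.canonical_inj_is_hom[OF group_BijGroup that]
    by (simp add: group_action_def id_def)
  then show ?thesis
    unfolding transitive_perm_group_def transitive_action_def transitive_action_axioms_def
    by auto
qed

text \<open>Normality in the form \<open>gN \<subseteq> Ng\<close>, which mentions no inverses.\<close>

lemma normal_perm_monoid_iff:
  assumes G: "subgroup G (BijGroup X)"
  shows "N \<lhd> perm_monoid X G \<longleftrightarrow> subgroup N (BijGroup X) \<and> N \<subseteq> G \<and>
    (\<forall>g\<in>G. \<forall>n\<in>N. \<exists>m\<in>N. compose X g n = compose X m g)"
proof -
  interpret B: group "BijGroup X" by (rule group_BijGroup)
  interpret group "perm_monoid X G" by (rule B.subgroup_imp_group[OF G])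
  have GB: "G \<subseteq> Bij X" by (rule subgroup_BijGroupD(1)[OF G])
  have sub: "subgroup N (perm_monoid X G) \<longleftrightarrow> subgroup N (BijGroup X) \<and> N \<subseteq> G"
    using B.incl_subgroup[OF G] B.subgroup_incl[OF _ G] subgroup.subset by fastforce
  have mult: "f \<otimes>\<^bsub>perm_monoid X G\<^esub> g = compose X f g" if "f \<in> G" "g \<in> G" for f g
  proof -
    have "f \<in> Bij X" "g \<in> Bij X" using that GB by auto
    then show ?thesis by (simp add: BijGroup_simps)
  qed
  have conj: "(g \<otimes>\<^bsub>perm_monoid X G\<^esub> n \<otimes>\<^bsub>perm_monoid X G\<^esub> inv\<^bsub>perm_monoid X G\<^esub> g \<in> N)
      \<longleftrightarrow> (\<exists>m\<in>N. compose X g n = compose X m g)" (is "?c \<in> N \<longleftrightarrow> _")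
    if "N \<subseteq> G" "g \<in> G" "n \<in> N" for g n
  proof -
    have car: "g \<in> carrier (perm_monoid X G)" "n \<in> carrier (perm_monoid X G)"
      using that by auto
    have eq: "?c = m \<longleftrightarrow> compose X g n = compose X m g" if "m \<in> G" for m
    proof -
      have "?c = m \<longleftrightarrow> g \<otimes>\<^bsub>perm_monoid X G\<^esub> n = m \<otimes>\<^bsub>perm_monoid X G\<^esub> g"
        using inv_solve_right'[of m "g \<otimes>\<^bsub>perm_monoid X G\<^esub> n" g] that car(1)
          m_closed[OF car] by simp
      then show ?thesis using mult that car by simp
    qed
    have "?c \<in> N \<longleftrightarrow> (\<exists>m\<in>N. ?c = m)" by simp
    also have "\<dots> \<longleftrightarrow> (\<exists>m\<in>N. compose X g n = compose X m g)"
      using eq \<open>N \<subseteq> G\<close> by (intro bex_cong) auto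
    finally show ?thesis .
  qed
  show ?thesis
    unfolding normal_inv_iff sub using conj by auto
qed

lemma orbits_perm_monoid: "orbits (perm_monoid X N) X (\<lambda>g. g) = {{g x | g. g \<in> N} | x. x \<in> X}"
  by (simp add: orbits_def orbit_def)

lemma trivial_on_iff: "trivial_on K Y \<longleftrightarrow> K \<noteq> {} \<and> (\<forall>k\<in>K. \<forall>y\<in>Y. k y = y)"
proof -
  have "restrict k Y = (\<lambda>y\<in>Y. y) \<longleftrightarrow> (\<forall>y\<in>Y. k y = y)" for k :: "'a \<Rightarrow> 'a"
    by (metis restrict_apply' restrict_ext)
  moreover have "f ` K = {c} \<longleftrightarrow> K \<noteq> {} \<and> (\<forall>k\<in>K. f k = c)" for f :: "('a \<Rightarrow> 'a) \<Rightarrow> ('a \<Rightarrow> 'a)" and c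
  proof -
    have "f ` K = {c} \<longleftrightarrow> f ` K \<noteq> {} \<and> f ` K \<subseteq> {c}" by (metis empty_not_insert order_refl subset_singletonD)
    then show ?thesis by (simp add: image_subset_iff)
  qed
  ultimately show ?thesis
    unfolding trivial_on_def induced_group_def BijGroup_simps(2) by simp
qed

lemma subgroup_induced_group:
  assumes K: "subgroup K (BijGroup X)" and "finite X" "Y \<subseteq> X" and inv: "\<And>k. k \<in> K \<Longrightarrow> k ` Y = Y"
  shows "subgroup (induced_group K Y) (BijGroup Y)"
proof (rule subgroup_BijGroupI)
  show "finite Y" using assms finite_subset by blast
  have "inj_on k Y" if "k \<in> K" for k
    using BijD(2)[of k X] subgroup_BijGroupD(1)[OF K] that inj_on_subset[OF _ \<open>Y \<subseteq> X\<close>] by blast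
  then show "induced_group K Y \<subseteq> Bij Y"
    using inv by (fastforce simp: induced_group_def Bij_def bij_betw_def inj_on_def)
  have "(\<lambda>y\<in>Y. y) = restrict (\<lambda>x\<in>X. x) Y"
    using \<open>Y \<subseteq> X\<close> by (auto simp: fun_eq_iff)
  then show "(\<lambda>y\<in>Y. y) \<in> induced_group K Y"
    unfolding induced_group_def using subgroup_BijGroupD(2)[OF K] by blast
  fix f g assume "f \<in> induced_group K Y" "g \<in> induced_group K Y"
  then obtain k l where kl: "k \<in> K" "l \<in> K" "f = restrict k Y" "g = restrict l Y"
    by (auto simp: induced_group_def)
  have "compose Y f g = restrict (compose X k l) Y"
  proof
    fix y
    have "l y \<in> Y" if "y \<in> Y" using inv[OF kl(2)] that by blast
    then show "compose Y f g y = restrict (compose X k l) Y y"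
      using kl(3,4) \<open>Y \<subseteq> X\<close> by (auto simp: compose_def)
  qed
  then show "compose Y f g \<in> induced_group K Y"
    unfolding induced_group_def using subgroup_BijGroupD(3)[OF K] kl by blast
qed

section \<open>Block systems as invariant partitions\<close>

lemma partition_on_eqI: "\<lbrakk>partition_on X P; A \<in> P; B \<in> P; x \<in> A; x \<in> B\<rbrakk> \<Longrightarrow> A = B"
  unfolding partition_on_def disjoint_def by blast

lemma partition_on_elem:
  assumes "partition_on X P" "B \<in> P"
  obtains x where "x \<in> B" "x \<in> X"
proof -
  have "B \<noteq> {}" "B \<subseteq> X" using assms by (auto simp: partition_on_def)
  then show ?thesis using that by blast
qed

lemma block_system_iff:
  assumes "transitive_perm_group X G" "X \<noteq> {}"
  shows "block_system X G P \<longleftrightarrow> partition_on X P \<and> (\<forall>g\<in>G. \<forall>B\<in>P. g ` B \<in> P)"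
proof
  have G: "subgroup G (BijGroup X)" and tr: "\<And>x y. \<lbrakk>x \<in> X; y \<in> X\<rbrakk> \<Longrightarrow> \<exists>g\<in>G. g x = y"
    using assms by (auto simp: transitive_perm_group_iff)
  note GD = subgroup_BijGroupD[OF G]
  have closed: "g x \<in> X" if "g \<in> G" "x \<in> X" for g x
    using GD(1) that BijD(1) by blast
  {
    assume "block_system X G P"
    then obtain B where "block X G B" "B \<noteq> {}" and P: "P = {g ` B | g. g \<in> G}"
      unfolding block_system_def by blast
    then have B: "B \<subseteq> X" "\<And>g. g \<in> G \<Longrightarrow> g ` B \<inter> B = {} \<or> g ` B \<inter> B = B" "B \<noteq> {}"
      unfolding block_def by auto
    have comp: "compose X f g ` B = f ` g ` B" for f g
      using B(1) by (rule image_compose_subset)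
    have inv: "g ` C \<in> P" if g: "g \<in> G" and C: "C \<in> P" for g C
    proof -
      obtain f where f: "f \<in> G" "C = f ` B" using C P by blast
      have "compose X g f \<in> G" using GD(3) g f by blast
      then show ?thesis using P f comp[of g f] by blast
    qed
    have eq: "g ` B = h ` B" if "g \<in> G" "h \<in> G" "x \<in> g ` B" "x \<in> h ` B" for g h x
    proof -
      \<comment> \<open>\<open>h\<^sup>-\<^sup>1 g B\<close> meets \<open>B\<close>, so it contains \<open>B\<close>; the other inclusion is by symmetry.\<close>
      have sub: "h ` B \<subseteq> g ` B" if gh: "g \<in> G" "h \<in> G" "x \<in> g ` B" "x \<in> h ` B" for g h
      proof -
        obtain h' where h': "h' \<in> G" "\<And>x. x \<in> X \<Longrightarrow> h' (h x) = x" "\<And>x. x \<in> X \<Longrightarrow> h (h' x) = x"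
          using subgroup_BijGroup_inverse[OF G gh(2)] by metis
        let ?f = "compose X h' g"
        have f: "?f \<in> G" using GD(3) gh h' by blast
        have fB: "?f ` B = h' ` g ` B" by (rule comp)
        obtain b where "b \<in> B" "x = h b" using gh(4) by blast
        then have "h' x \<in> B" using h'(2) B(1) by auto
        then have "?f ` B \<inter> B \<noteq> {}" using gh(3) fB by blast
        then have BB: "B \<subseteq> h' ` g ` B" using B(2)[OF f] fB by blast
        show ?thesis
        proof
          fix y assume "y \<in> h ` B"
          then obtain b where b: "b \<in> B" "y = h (h' (g b))" using BB by blast
          then have "y = g b" using h'(3) closed[OF gh(1)] B(1) by blast
          then show "y \<in> g ` B" using b by blast
        qed
      qed
      show ?thesis using sub that by blast
    qed
    have "partition_on X P"
    proof (rule partition_onI)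
      show "\<Union>P = X"
      proof
        show "\<Union>P \<subseteq> X" using P B(1) closed by auto
        show "X \<subseteq> \<Union>P"
        proof
          fix y assume y: "y \<in> X"
          obtain x where x: "x \<in> B" using B(3) by blast
          then obtain g where "g \<in> G" "g x = y" using tr y B(1) by blast
          then show "y \<in> \<Union>P" using P x by blast
        qed
      qed
      show "{} \<notin> P" using P B(3) by auto
      show "disjnt p q" if pq: "p \<in> P" "q \<in> P" "p \<noteq> q" for p q
      proof -
        obtain g h where "g \<in> G" "h \<in> G" "p = g ` B" "q = h ` B" using pq P by blast
        then show ?thesis using eq pq(3) unfolding disjnt_def by blast
      qed
    qed
    with inv show "partition_on X P \<and> (\<forall>g\<in>G. \<forall>B\<in>P. g ` B \<in> P)" by blast
  }
  {
    assume "partition_on X P \<and> (\<forall>g\<in>G. \<forall>B\<in>P. g ` B \<in> P)"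
    then have P: "partition_on X P" and inv: "\<And>g B. \<lbrakk>g \<in> G; B \<in> P\<rbrakk> \<Longrightarrow> g ` B \<in> P" by auto
    obtain B where B: "B \<in> P"
      using P assms(2) by (auto simp: partition_on_def)
    then have BX: "B \<subseteq> X" "B \<noteq> {}" using P by (auto simp: partition_on_def)
    then obtain x where x: "x \<in> B" by blast
    have "block X G B"
      unfolding block_def using BX partition_on_eqI[OF P _ B] inv[OF _ B] by fastforce
    moreover have "P \<subseteq> {g ` B | g. g \<in> G}"
    proof
      fix C assume C: "C \<in> P"
      then obtain y where y: "y \<in> C" "y \<in> X" using partition_on_elem[OF P] by blast
      then obtain g where g: "g \<in> G" "g x = y" using tr x BX by blast
      then have "C = g ` B" using partition_on_eqI[OF P C inv[OF g(1) B] y(1)] x by blast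
      then show "C \<in> {g ` B | g. g \<in> G}" using g by blast
    qed
    ultimately show "block_system X G P"
      unfolding block_system_def using BX inv B by blast
  }
qed

lemma block_system_nonempty: "block_system X G P \<Longrightarrow> X \<noteq> {}"
  unfolding block_system_def block_def by blast

lemma normal_block_system_partition_on:
  assumes "transitive_perm_group X G" "normal_block_system X G P"
  shows "partition_on X P" "\<And>g B. \<lbrakk>g \<in> G; B \<in> P\<rbrakk> \<Longrightarrow> g ` B \<in> P"
proof -
  have bs: "block_system X G P" using assms(2) by (simp add: normal_block_system_def)
  note iff = block_system_iff[OF assms(1) block_system_nonempty[OF bs]]
  show "partition_on X P" "\<And>g B. \<lbrakk>g \<in> G; B \<in> P\<rbrakk> \<Longrightarrow> g ` B \<in> P" using bs iff by simp_all
qed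

text \<open>A normal subgroup whose orbits are the blocks lies in the fixer of the block system.\<close>

lemma block_fixer_transitive_on_blocks:
  assumes tr: "transitive_perm_group X G" and nb: "normal_block_system X G P"
    and "B \<in> P" "x \<in> B" "y \<in> B"
  obtains g where "g \<in> block_fixer G P" "g x = y"
proof -
  have G: "subgroup G (BijGroup X)" using tr by (simp add: transitive_perm_group_iff)
  obtain N where "N \<lhd> perm_monoid X G" and P: "P = {{g x | g. g \<in> N} | x. x \<in> X}"
    using nb unfolding normal_block_system_def orbits_perm_monoid by blast
  then have N: "subgroup N (BijGroup X)" "N \<subseteq> G"
    using normal_perm_monoid_iff[OF G] by auto
  note ND = subgroup_BijGroupD[OF N(1)]
  note part = normal_block_system_partition_on[OF tr nb]
  have orb: "A = {g z | g. g \<in> N}" if "A \<in> P" "z \<in> A" for A z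
  proof -
    have "z \<in> X" using that part(1) by (auto simp: partition_on_def)
    then have "{g z | g. g \<in> N} \<in> P" using P by blast
    moreover have "(\<lambda>x\<in>X. x) z = z" using \<open>z \<in> X\<close> by simp
    then have "z \<in> {g z | g. g \<in> N}" using ND(2) by (metis (mono_tags, lifting) mem_Collect_eq)
    ultimately show ?thesis using partition_on_eqI[OF part(1)] that by blast
  qed
  have "n \<in> block_fixer G P" if n: "n \<in> N" for n
  proof -
    have "n ` A = A" if A: "A \<in> P" for A
    proof -
      obtain z where z: "z \<in> A" using A partition_on_elem[OF part(1)] by blast
      have "n ` A \<in> P" using part(2) n N(2) A by blast
      moreover have "n z \<in> A" using orb[OF A z] n by blast
      ultimately show ?thesis using partition_on_eqI[OF part(1) _ A] z by blast
    qed
    then show ?thesis using n N(2) by (auto simp: block_fixer_def)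
  qed
  moreover obtain n where "n \<in> N" "n x = y" using orb assms(3-5) by blast
  ultimately show ?thesis using that by blast
qed

section \<open>Wreath stabilizers and fixer block systems\<close>

lemma wstab_fixes:
  assumes "B \<subseteq> X" "k \<in> wstab X G P B" "x \<in> B"
  shows "k x = x"
proof -
  interpret group "BijGroup X" by (rule group_BijGroup)
  have cand: "k \<in> Bij X \<and> (\<forall>x\<in>B. k x = x)"
    if "k \<in> \<Union>{K. wstab_candidate X G P B K}" for k
    using that subgroup_BijGroupD(1)
    unfolding wstab_candidate_def trivial_on_iff by blast
  have "k \<in> Bij X \<and> (\<forall>x\<in>B. k x = x)" if "k \<in> wstab X G P B" for k
    using that unfolding wstab_def
  proof (induction rule: generate.induct)
    case one
    show ?case
      unfolding BijGroup_simps(2) using assms(1) id_Bij[of X] by (metis restrict_apply' subsetD)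
  next
    case (incl h)
    then show ?case by (rule cand)
  next
    case (inv h)
    then obtain K where K: "wstab_candidate X G P B K" "h \<in> K" by blast
    then have "inv\<^bsub>BijGroup X\<^esub> h \<in> K"
      using subgroup.m_inv_closed[of K "BijGroup X" h] by (simp add: wstab_candidate_def)
    then show ?case using cand K by blast
  next
    case (eng h1 h2)
    then show ?case using assms(1) by (auto simp: BijGroup_simps compose_Bij compose_eq)
  qed
  then show ?thesis using assms by blast
qed

text \<open>Blocks with the same wreath stabilizer have the same candidates: each candidate
  for one block lies in the common wreath stabilizer, so it is trivial on the other block.
  Thus the equivalence of blocks can be decided on candidates, and it never matters that
  the group that they generate is itself a candidate.\<close>

lemma wstab_eq_iff:
  assumes "B \<subseteq> X" "C \<subseteq> X"
  shows "wstab X G P B = wstab X G P C \<longleftrightarrow>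
    (\<forall>K. wstab_candidate X G P B K \<longleftrightarrow> wstab_candidate X G P C K)"
proof
  have *: "wstab_candidate X G P C K"
    if C: "C \<subseteq> X" and eq: "wstab X G P B = wstab X G P C" and K: "wstab_candidate X G P B K"
    for B C K
  proof -
    have "k \<in> wstab X G P B" if "k \<in> K" for k
      unfolding wstab_def using K that by (intro generate.incl) auto
    then have "\<forall>k\<in>K. \<forall>x\<in>C. k x = x" using eq wstab_fixes[OF C] by blast
    then show ?thesis using K unfolding wstab_candidate_def trivial_on_iff by auto
  qed
  assume "wstab X G P B = wstab X G P C"
  then show "\<forall>K. wstab_candidate X G P B K \<longleftrightarrow> wstab_candidate X G P C K"
    using *[OF assms(1), of C] *[OF assms(2), of B] by metis
qed (simp add: wstab_def)

lemma Union_fixer_block_system: "\<Union>(fixer_block_system X G P) = \<Union>P"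
  unfolding fixer_block_system_def by blast

lemma fixer_block_system_disjoint:
  assumes "partition_on X P" "E \<in> fixer_block_system X G P" "F \<in> fixer_block_system X G P" "E \<noteq> F"
  shows "E \<inter> F = {}"
proof (rule ccontr)
  assume "E \<inter> F \<noteq> {}"
  then obtain x where x: "x \<in> E" "x \<in> F" by blast
  obtain B C where E: "E = \<Union>{B' \<in> P. wstab X G P B = wstab X G P B'}"
    and F: "F = \<Union>{B' \<in> P. wstab X G P C = wstab X G P B'}"
    using assms(2,3) unfolding fixer_block_system_def by blast
  obtain B' where B': "B' \<in> P" "wstab X G P B = wstab X G P B'" "x \<in> B'" using x E by blast
  obtain C' where C': "C' \<in> P" "wstab X G P C = wstab X G P C'" "x \<in> C'" using x F by blast
  have "B' = C'" using partition_on_eqI[OF assms(1)] B' C' by blast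
  then have "E = F" using E F B'(2) C'(2) by simp
  with assms(4) show False by blast
qed

lemma perm_restrict_apply:
  "perm_restrict X g Y x = (if x \<in> X then if x \<in> Y then g x else x else undefined)"
  by (simp add: perm_restrict_def)

text \<open>In a 5/2-closed group, restriction to one fixer block can be iterated:
  \<open>g\<close> restricted to a union of fixer blocks is the product of its restrictions to them.\<close>

lemma five_halves_closed_restrict_Union:
  assumes G: "five_halves_closed X G"
    and H: "transitive_perm_group X H" "H \<subseteq> G" "normal_block_system X H P"
    and F: "\<F> \<subseteq> fixer_block_system X H P"
    and g: "g \<in> G" "\<And>B. \<lbrakk>B \<in> P; B \<subseteq> \<Union>\<F>\<rbrakk> \<Longrightarrow> g ` B = B"
  shows "perm_restrict X g (\<Union>\<F>) \<in> G"
proof -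
  have fX: "finite X" and GS: "subgroup G (BijGroup X)"
    using G by (auto simp: five_halves_closed_def transitive_perm_group_iff)
  have part: "partition_on X P" using normal_block_system_partition_on(1)[OF H(1,3)] .
  have "\<Union>(fixer_block_system X H P) = X"
    using part Union_fixer_block_system by (metis partition_onD1)
  then have "\<F> \<subseteq> Pow X" using F by blast
  then have "finite \<F>" using fX finite_subset by blast
  then show ?thesis using F g(2)
  proof (induction \<F>)
    case empty
    have "perm_restrict X g (\<Union>{}) = (\<lambda>x\<in>X. x)" by (simp add: perm_restrict_def)
    then show ?case using subgroup_BijGroupD(2)[OF GS] by metis
  next
    case (insert E \<F>)
    have 1: "perm_restrict X g (\<Union>\<F>) \<in> G"
    proof (rule insert.IH)
      show "\<F> \<subseteq> fixer_block_system X H P" using insert.prems(1) by simp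
      show "g ` B = B" if "B \<in> P" "B \<subseteq> \<Union>\<F>" for B using insert.prems(2) that by auto
    qed
    have "\<forall>B\<in>P. B \<subseteq> E \<longrightarrow> g ` B = B" using insert.prems(2) by auto
    moreover have "E \<in> fixer_block_system X H P" using insert.prems(1) by simp
    ultimately have 2: "perm_restrict X g E \<in> G"
      using G H g(1) unfolding five_halves_closed_def by blast
    have "E \<inter> F = {}" if "F \<in> \<F>" for F
      using that insert.prems(1) insert.hyps(2)
      by (intro fixer_block_system_disjoint[OF part]) auto
    then have disj: "E \<inter> \<Union>\<F> = {}" by blast
    have gE: "g x \<in> E" if x: "x \<in> E" for x
    proof -
      obtain C where E: "E = \<Union>{B' \<in> P. wstab X H P C = wstab X H P B'}"
        using \<open>E \<in> fixer_block_system X H P\<close> by (auto simp: fixer_block_system_def)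
      obtain B where B: "B \<in> P" "wstab X H P C = wstab X H P B" "x \<in> B" using x E by auto
      have "B \<subseteq> E" using E B(1,2) by auto
      then have "g ` B = B" using B(1) by (intro insert.prems(2)) auto
      then show ?thesis using \<open>B \<subseteq> E\<close> B(3) by auto
    qed
    have EX: "E \<subseteq> X"
      using \<open>E \<in> fixer_block_system X H P\<close> \<open>\<Union>(fixer_block_system X H P) = X\<close> by auto
    have "compose X (perm_restrict X g (\<Union>\<F>)) (perm_restrict X g E)
        = perm_restrict X g (\<Union>(insert E \<F>))"
    proof
      fix x
      have "x \<notin> \<Union>\<F> \<and> g x \<notin> \<Union>\<F> \<and> g x \<in> X" if "x \<in> E"
        using gE[OF that] that disj EX by auto
      then show "compose X (perm_restrict X g (\<Union>\<F>)) (perm_restrict X g E) x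
          = perm_restrict X g (\<Union>(insert E \<F>)) x"
        by (cases "x \<in> E"; cases "x \<in> X") (simp_all add: compose_def perm_restrict_apply)
    qed
    then show ?case using subgroup_BijGroupD(3)[OF GS 1 2] by simp
  qed
qed

section \<open>Lifting along the quotient by a normal block system\<close>

text \<open>A transitive group with a normal block system, whose quotient is to be studied.\<close>

locale normal_quotient =
  fixes X :: "'a set" and G :: "('a \<Rightarrow> 'a) set" and \<B> :: "'a set set"
  assumes trans: "transitive_perm_group X G" and normal: "normal_block_system X G \<B>"
begin

lemma fin: "finite X" and subgroup: "subgroup G (BijGroup X)"
  using trans by (auto simp: transitive_perm_group_iff)

lemma partition: "partition_on X \<B>" and image_block: "\<lbrakk>g \<in> G; B \<in> \<B>\<rbrakk> \<Longrightarrow> g ` B \<in> \<B>"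
  using normal_block_system_partition_on[OF trans normal] by auto

lemma block_subset: "B \<in> \<B> \<Longrightarrow> B \<subseteq> X"
  using partition by (auto simp: partition_on_def)

lemma finite_blocks: "finite \<B>"
  using fin partition finite_elements by blast

lemma quotient_perm_apply: "B \<in> \<B> \<Longrightarrow> quotient_perm \<B> g B = g ` B"
  by (simp add: quotient_perm_def)

lemma quotient_perm_Bij:
  assumes "g \<in> G" shows "quotient_perm \<B> g \<in> Bij \<B>"
proof -
  have inj: "inj_on g X" using BijD(2) subgroup_BijGroupD(1)[OF subgroup] assms by blast
  have "inj_on (quotient_perm \<B> g) \<B>"
  proof (rule inj_onI)
    fix B C assume "B \<in> \<B>" "C \<in> \<B>" "quotient_perm \<B> g B = quotient_perm \<B> g C"
    then show "B = C"
      using inj_on_image_eq_iff[OF inj block_subset block_subset] by (simp add: quotient_perm_apply)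
  qed
  moreover have "quotient_perm \<B> g ` \<B> \<subseteq> \<B>"
    using image_block[OF assms] by (auto simp: quotient_perm_apply)
  ultimately have "bij_betw (quotient_perm \<B> g) \<B> \<B>"
    using endo_inj_surj[OF finite_blocks] by (auto simp: bij_betw_def)
  then show ?thesis by (simp add: Bij_def quotient_perm_def)
qed

lemma quotient_perm_compose:
  assumes "g \<in> G"
  shows "quotient_perm \<B> (compose X f g) = compose \<B> (quotient_perm \<B> f) (quotient_perm \<B> g)"
proof
  fix B
  show "quotient_perm \<B> (compose X f g) B = compose \<B> (quotient_perm \<B> f) (quotient_perm \<B> g) B"
    by (cases "B \<in> \<B>")
      (simp_all add: quotient_perm_def compose_def[of \<B>] image_block[OF assms]
        image_compose_subset[OF block_subset])
qed

lemma quotient_perm_eq_id: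
  assumes "\<And>B. B \<in> \<B> \<Longrightarrow> g ` B = B"
  shows "quotient_perm \<B> g = (\<lambda>B\<in>\<B>. B)"
  using assms by (auto simp: quotient_perm_def fun_eq_iff)

lemma quotient_perm_id: "quotient_perm \<B> (\<lambda>x\<in>X. x) = (\<lambda>B\<in>\<B>. B)"
proof (rule quotient_perm_eq_id)
  fix B assume "B \<in> \<B>"
  then show "(\<lambda>x\<in>X. x) ` B = B" using block_subset by (simp add: subset_iff)
qed

text \<open>The preimage in \<open>G\<close> of a set \<open>K\<close> of permutations of \<open>\<B>\<close>; it is meant for subgroups \<open>K\<close> of
  \<open>G/\<B>\<close>, although elements of \<open>K\<close> outside \<open>G/\<B>\<close> do no harm.\<close>

definition preimage_group :: "('a set \<Rightarrow> 'a set) set \<Rightarrow> ('a \<Rightarrow> 'a) set" where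
  "preimage_group K = {g \<in> G. quotient_perm \<B> g \<in> K}"

lemma subgroup_preimage_group:
  assumes "subgroup K (BijGroup \<B>)"
  shows "subgroup (preimage_group K) (BijGroup X)"
proof (rule subgroup_BijGroupI[OF fin])
  note D = subgroup_BijGroupD[OF subgroup] and KD = subgroup_BijGroupD[OF assms]
  show "preimage_group K \<subseteq> Bij X" using D(1) by (auto simp: preimage_group_def)
  show "(\<lambda>x\<in>X. x) \<in> preimage_group K"
    unfolding preimage_group_def mem_Collect_eq quotient_perm_id using D(2) KD(2) by blast
  fix f g assume "f \<in> preimage_group K" "g \<in> preimage_group K"
  then show "compose X f g \<in> preimage_group K"
    using D(3) KD(3) by (auto simp: preimage_group_def quotient_perm_compose)
qed

lemma quotient_group_preimage_group:
  "K \<subseteq> quotient_group G \<B> \<Longrightarrow> quotient_group (preimage_group K) \<B> = K"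
  by (auto simp: quotient_group_def preimage_group_def)

text \<open>The preimage contains the fixer of the block system, which is transitive on each block.
  So an element of the quotient lifts to an element with prescribed value at a point.\<close>

lemma preimage_group_moves:
  assumes "subgroup K (BijGroup \<B>)" "K \<subseteq> quotient_group G \<B>"
    and "k \<in> K" "B \<in> \<B>" "x \<in> B" "y \<in> k B"
  obtains g where "g \<in> preimage_group K" "g x = y"
proof -
  obtain f where f: "f \<in> G" "k = quotient_perm \<B> f"
    using assms(2,3) by (auto simp: quotient_group_def)
  have kB: "k B = f ` B" using f(2) assms(4) by (simp add: quotient_perm_apply)
  then have "k B \<in> \<B>" using image_block[OF f(1) assms(4)] by simp
  moreover have "f x \<in> k B" using kB assms(5) by simp
  ultimately obtain h where h: "h \<in> block_fixer G \<B>" "h (f x) = y"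
    using block_fixer_transitive_on_blocks[OF trans normal] assms(6) by metis
  have hG: "h \<in> G" and hB: "\<And>B. B \<in> \<B> \<Longrightarrow> h ` B = B" using h(1) by (auto simp: block_fixer_def)
  have "quotient_perm \<B> (compose X h f) = quotient_perm \<B> f"
  proof
    fix B show "quotient_perm \<B> (compose X h f) B = quotient_perm \<B> f B"
      by (cases "B \<in> \<B>")
        (simp_all add: quotient_perm_def image_compose_subset[OF block_subset] hB image_block[OF f(1)])
  qed
  then have "compose X h f \<in> preimage_group K"
    using subgroup_BijGroupD(3)[OF subgroup hG f(1)] f(2) assms(3) by (simp add: preimage_group_def)
  moreover have "compose X h f x = y"
    using h(2) block_subset[OF assms(4)] assms(5) by (auto simp: compose_def)
  ultimately show ?thesis using that by blast
qed

lemma orbit_preimage_group: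
  assumes "subgroup K (BijGroup \<B>)" "K \<subseteq> quotient_group G \<B>" "B \<in> \<B>" "x \<in> B"
  shows "{g x | g. g \<in> preimage_group K} = \<Union>{k B | k. k \<in> K}"
proof
  show "{g x | g. g \<in> preimage_group K} \<subseteq> \<Union>{k B | k. k \<in> K}"
  proof clarify
    fix g assume g: "g \<in> preimage_group K"
    have "g x \<in> quotient_perm \<B> g B" using assms(3,4) by (simp add: quotient_perm_apply)
    then show "g x \<in> \<Union>{k B | k. k \<in> K}" using g unfolding preimage_group_def by blast
  qed
  show "\<Union>{k B | k. k \<in> K} \<subseteq> {g x | g. g \<in> preimage_group K}"
  proof clarify
    fix k y assume "k \<in> K" "y \<in> k B"
    then obtain g where "g \<in> preimage_group K" "g x = y"
      using preimage_group_moves[OF assms(1,2) _ assms(3,4)] by blast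
    then show "\<exists>g. y = g x \<and> g \<in> preimage_group K" by blast
  qed
qed

lemma transitive_perm_group_quotient: "transitive_perm_group \<B> (quotient_group G \<B>)"
  unfolding transitive_perm_group_iff
proof (intro conjI ballI)
  note D = subgroup_BijGroupD[OF subgroup]
  show "subgroup (quotient_group G \<B>) (BijGroup \<B>)"
  proof (rule subgroup_BijGroupI[OF finite_blocks])
    show "quotient_group G \<B> \<subseteq> Bij \<B>" using quotient_perm_Bij by (auto simp: quotient_group_def)
    show "(\<lambda>B\<in>\<B>. B) \<in> quotient_group G \<B>"
      unfolding quotient_group_def using quotient_perm_id D(2) by (metis imageI)
    fix f g assume "f \<in> quotient_group G \<B>" "g \<in> quotient_group G \<B>"
    then obtain f' g' where "f' \<in> G" "g' \<in> G" "f = quotient_perm \<B> f'" "g = quotient_perm \<B> g'"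
      by (auto simp: quotient_group_def)
    then show "compose \<B> f g \<in> quotient_group G \<B>"
      unfolding quotient_group_def using D(3) quotient_perm_compose by (metis imageI)
  qed
  fix B C assume BC: "B \<in> \<B>" "C \<in> \<B>"
  obtain x where x: "x \<in> B" "x \<in> X" using partition BC(1) by (rule partition_on_elem)
  obtain y where y: "y \<in> C" "y \<in> X" using partition BC(2) by (rule partition_on_elem)
  obtain g where g: "g \<in> G" "g x = y" using trans x y by (auto simp: transitive_perm_group_iff)
  have "g ` B = C"
    using partition_on_eqI[OF partition image_block[OF g(1) BC(1)] BC(2) _ y(1)] x g by blast
  then show "\<exists>g\<in>quotient_group G \<B>. g B = C"
    using g(1) BC(1) quotient_perm_apply unfolding quotient_group_def by blast
qed (rule finite_blocks)

lemma transitive_perm_group_preimage: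
  assumes "transitive_perm_group \<B> H" "H \<subseteq> quotient_group G \<B>"
  shows "transitive_perm_group X (preimage_group H)"
proof -
  have H: "subgroup H (BijGroup \<B>)" and tr: "\<And>B C. \<lbrakk>B \<in> \<B>; C \<in> \<B>\<rbrakk> \<Longrightarrow> \<exists>h\<in>H. h B = C"
    using assms(1) by (auto simp: transitive_perm_group_iff)
  have "\<exists>g\<in>preimage_group H. g x = y" if "x \<in> X" "y \<in> X" for x y
  proof -
    have "x \<in> \<Union>\<B>" "y \<in> \<Union>\<B>" using that partition by (simp_all add: partition_on_def)
    then obtain B C where BC: "B \<in> \<B>" "x \<in> B" "C \<in> \<B>" "y \<in> C" by blast
    then obtain h where "h \<in> H" "h B = C" using tr by blast
    then show ?thesis using preimage_group_moves[OF H assms(2) _ BC(1,2)] BC(4) by metis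
  qed
  then show ?thesis
    using fin subgroup_preimage_group[OF H] by (auto simp: transitive_perm_group_iff)
qed

lemma normal_preimage_group:
  assumes "subgroup H (BijGroup \<B>)" "N \<lhd> perm_monoid \<B> H"
  shows "preimage_group N \<lhd> perm_monoid X (preimage_group H)"
proof -
  have N: "subgroup N (BijGroup \<B>)" "N \<subseteq> H"
    and norm: "\<And>g n. \<lbrakk>g \<in> H; n \<in> N\<rbrakk> \<Longrightarrow> \<exists>m\<in>N. compose \<B> g n = compose \<B> m g"
    using assms normal_perm_monoid_iff by blast+
  note D = subgroup_BijGroupD[OF subgroup]
  have "\<exists>m\<in>preimage_group N. compose X g n = compose X m g"
    if g: "g \<in> preimage_group H" and n: "n \<in> preimage_group N" for g n
  proof -
    have gG: "g \<in> G" and nG: "n \<in> G" using g n by (auto simp: preimage_group_def)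
    obtain h where h: "h \<in> G" "\<And>x. x \<in> X \<Longrightarrow> h (g x) = x" "\<And>x. x \<in> X \<Longrightarrow> g (h x) = x"
      using subgroup_BijGroup_inverse[OF subgroup gG] by metis
    obtain m' where m': "m' \<in> N"
      "compose \<B> (quotient_perm \<B> g) (quotient_perm \<B> n) = compose \<B> m' (quotient_perm \<B> g)"
      using norm g n by (auto simp: preimage_group_def)
    \<comment> \<open>\<open>h\<close> is the inverse of \<open>g\<close>, so \<open>m\<close> is the conjugate of \<open>n\<close> by \<open>g\<close>.\<close>
    define m where "m = compose X (compose X g n) h"
    have mG: "m \<in> G" unfolding m_def using D(3) gG nG h(1) by blast
    have "quotient_perm \<B> m = m'"
    proof (rule Bij_eqI)
      show "quotient_perm \<B> m \<in> Bij \<B>" by (rule quotient_perm_Bij[OF mG])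
      show "m' \<in> Bij \<B>" using m'(1) subgroup_BijGroupD(1)[OF N(1)] by blast
      fix B assume B: "B \<in> \<B>"
      have hB: "h ` B \<in> \<B>" by (rule image_block[OF h(1) B])
      have ghB: "g ` h ` B = B" using h(3) block_subset[OF B] by (force simp: image_image subset_iff)
      have "quotient_perm \<B> m B = g ` n ` h ` B"
        using B hB block_subset by (simp add: m_def quotient_perm_apply image_compose_subset)
      also have "\<dots> = compose \<B> (quotient_perm \<B> g) (quotient_perm \<B> n) (h ` B)"
        using hB image_block[OF nG hB] by (simp add: compose_def quotient_perm_apply)
      also have "\<dots> = m' B"
        unfolding m'(2) using hB ghB by (simp add: compose_def quotient_perm_apply)
      finally show "quotient_perm \<B> m B = m' B" .
    qed
    then have "m \<in> preimage_group N" using mG m'(1) by (simp add: preimage_group_def)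
    moreover have "compose X g n = compose X m g"
    proof
      fix x
      have "g x \<in> X" if "x \<in> X" using that BijD(1)[of g X] D(1) gG by blast
      then show "compose X g n x = compose X m g x"
        using h(2) by (cases "x \<in> X") (simp_all add: m_def compose_def)
    qed
    ultimately show ?thesis by blast
  qed
  moreover have "preimage_group N \<subseteq> preimage_group H" using N(2) by (auto simp: preimage_group_def)
  ultimately show ?thesis
    unfolding normal_perm_monoid_iff[OF subgroup_preimage_group[OF assms(1)]]
    using subgroup_preimage_group[OF N(1)] by blast
qed

lemma block_subset_Union_iff:
  assumes "C \<subseteq> \<B>" "B \<in> \<B>" shows "B \<subseteq> \<Union>C \<longleftrightarrow> B \<in> C"
proof
  obtain x where x: "x \<in> B" using partition assms(2) by (rule partition_on_elem)
  assume "B \<subseteq> \<Union>C"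
  then obtain D where "D \<in> C" "x \<in> D" using x by blast
  then show "B \<in> C" using partition_on_eqI[OF partition assms(2) _ x] assms(1) by blast
qed blast

lemma image_Union_blocks:
  assumes "C \<subseteq> \<B>" shows "g ` \<Union>C = \<Union>(quotient_perm \<B> g ` C)"
proof -
  have "quotient_perm \<B> g ` C = image g ` C"
    using assms by (intro image_cong) (auto simp: quotient_perm_apply)
  then show ?thesis by (simp add: image_Union)
qed

lemma quotient_unquotient_system:
  assumes "partition_on \<B> \<C>"
  shows "quotient_system (unquotient_system \<C>) \<B> = \<C>"
proof -
  have "{B \<in> \<B>. B \<subseteq> \<Union>C} = C" if "C \<in> \<C>" for C
  proof -
    have "C \<subseteq> \<B>" using assms that by (auto simp: partition_on_def)
    then show ?thesis using block_subset_Union_iff by blast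
  qed
  then have "(\<lambda>C. {B \<in> \<B>. B \<subseteq> \<Union>C}) ` \<C> = \<C>" by simp
  moreover have "quotient_system (unquotient_system \<C>) \<B> = (\<lambda>C. {B \<in> \<B>. B \<subseteq> \<Union>C}) ` \<C>"
    unfolding quotient_system_def unquotient_system_def by blast
  ultimately show ?thesis by simp
qed

lemma refines_unquotient_system:
  assumes "partition_on \<B> \<C>"
  shows "refines \<B> (unquotient_system \<C>)"
  using assms unfolding refines_def unquotient_system_def partition_on_def by blast

lemma partition_on_unquotient_system:
  assumes "partition_on \<B> \<C>"
  shows "partition_on X (unquotient_system \<C>)"
proof (rule partition_onI)
  have sub: "\<And>C. C \<in> \<C> \<Longrightarrow> C \<subseteq> \<B>" using assms by (auto simp: partition_on_def)
  have "\<Union>(unquotient_system \<C>) = \<Union>(\<Union>\<C>)" unfolding unquotient_system_def by blast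
  then show "\<Union>(unquotient_system \<C>) = X"
    using assms partition by (simp add: partition_on_def)
  show "{} \<notin> unquotient_system \<C>"
  proof
    assume "{} \<in> unquotient_system \<C>"
    then obtain C where C: "C \<in> \<C>" "\<Union>C = {}" by (auto simp: unquotient_system_def)
    obtain B where B: "B \<in> C" "B \<in> \<B>" using assms C(1) by (rule partition_on_elem)
    obtain x where "x \<in> B" using partition B(2) by (rule partition_on_elem)
    then show False using B(1) C(2) by blast
  qed
  fix p q assume "p \<in> unquotient_system \<C>" "q \<in> unquotient_system \<C>" and neq: "p \<noteq> q"
  then obtain C D where CD: "C \<in> \<C>" "D \<in> \<C>" "p = \<Union>C" "q = \<Union>D" by (auto simp: unquotient_system_def)
  show "disjnt p q"
  proof (rule ccontr)
    assume "\<not> disjnt p q"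
    then obtain x B B' where x: "B \<in> C" "B' \<in> D" "x \<in> B" "x \<in> B'"
      using CD by (auto simp: disjnt_def)
    then have "B = B'" using partition_on_eqI[OF partition] sub CD by blast
    then have "C = D" using partition_on_eqI[OF assms CD(1,2)] x by blast
    then show False using neq CD by blast
  qed
qed

lemma normal_block_system_unquotient:
  assumes H: "transitive_perm_group \<B> H" "H \<subseteq> quotient_group G \<B>"
    and C: "normal_block_system \<B> H \<C>"
  shows "normal_block_system X (preimage_group H) (unquotient_system \<C>)"
proof -
  have HS: "subgroup H (BijGroup \<B>)" using H(1) by (simp add: transitive_perm_group_iff)
  note part = normal_block_system_partition_on[OF H(1) C]
  have ne: "X \<noteq> {}"
    using block_system_nonempty normal unfolding normal_block_system_def by blast
  have inv: "g ` A \<in> unquotient_system \<C>"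
    if g: "g \<in> preimage_group H" and A: "A \<in> unquotient_system \<C>" for g A
  proof -
    obtain C where C: "C \<in> \<C>" "A = \<Union>C" using A by (auto simp: unquotient_system_def)
    have "C \<subseteq> \<B>" using part(1) C(1) by (auto simp: partition_on_def)
    then have "g ` A = \<Union>(quotient_perm \<B> g ` C)" using C(2) image_Union_blocks by simp
    moreover have "quotient_perm \<B> g ` C \<in> \<C>"
      using part(2) C(1) g by (simp add: preimage_group_def)
    ultimately show ?thesis unfolding unquotient_system_def by blast
  qed
  have bs: "block_system X (preimage_group H) (unquotient_system \<C>)"
    unfolding block_system_iff[OF transitive_perm_group_preimage[OF H] ne]
    using inv partition_on_unquotient_system[OF part(1)] by blast
  obtain N where N: "N \<lhd> perm_monoid \<B> H" and \<C>: "\<C> = {{n B | n. n \<in> N} | B. B \<in> \<B>}"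
    using C unfolding normal_block_system_def orbits_perm_monoid by blast
  have NS: "subgroup N (BijGroup \<B>)" "N \<subseteq> quotient_group G \<B>"
    using N normal_perm_monoid_iff[OF HS] H(2) by auto
  note orbit = orbit_preimage_group[OF NS]
  have "unquotient_system \<C> = {{g x | g. g \<in> preimage_group N} | x. x \<in> X}"
  proof (intro subset_antisym subsetI)
    fix A assume "A \<in> unquotient_system \<C>"
    then obtain B where B: "B \<in> \<B>" "A = \<Union>{n B | n. n \<in> N}"
      unfolding unquotient_system_def \<C> by blast
    obtain x where x: "x \<in> B" "x \<in> X" using partition B(1) by (rule partition_on_elem)
    have "A = {g x | g. g \<in> preimage_group N}" using B orbit x by simp
    then show "A \<in> {{g x | g. g \<in> preimage_group N} | x. x \<in> X}" using x(2) by blast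
  next
    fix A assume "A \<in> {{g x | g. g \<in> preimage_group N} | x. x \<in> X}"
    then obtain x where x: "x \<in> X" "A = {g x | g. g \<in> preimage_group N}" by blast
    obtain B where B: "B \<in> \<B>" "x \<in> B" using x(1) partition by (auto simp: partition_on_def)
    have "A = \<Union>{n B | n. n \<in> N}" using x orbit B by simp
    moreover have "{n B | n. n \<in> N} \<in> \<C>" unfolding \<C> using B(1) by blast
    ultimately show "A \<in> unquotient_system \<C>" unfolding unquotient_system_def by blast
  qed
  then show ?thesis
    unfolding normal_block_system_def orbits_perm_monoid
    using bs normal_preimage_group[OF HS N] by blast
qed

section \<open>Comparing fixer block systems of a group and its quotient\<close>

text \<open>The full preimage of a candidate \<open>K\<close> is of no use as a candidate in the preimage of \<open>H\<close>,
  because it is transitive on every block of \<open>\<B>\<close>, also where \<open>K\<close> is trivial.  The remedy is to cut it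
  down to the pointwise stabilizer \<open>L\<close> of the union \<open>Y\<close> of the blocks in the members of \<open>\<C>\<close> on which
  \<open>K\<close> is trivial.  The assumption on the fixer block systems serves to show that \<open>Y\<close> is a union of
  fixer blocks of \<open>G\<close>, and 5/2-closedness then shows that \<open>L\<close> acts off \<open>Y\<close> as the full preimage
  does.\<close>

lemma candidate_trivial_on_equivalent_block:
  assumes five: "five_halves_closed X G"
    and H: "transitive_perm_group \<B> H" "H \<subseteq> quotient_group G \<B>" "normal_block_system \<B> H \<C>"
    and ref: "refines (fixer_block_system X G \<B>) (unquotient_system (fixer_block_system \<B> H \<C>))"
    and CD: "C \<in> \<C>" "D \<in> \<C>"
    and eq: "wstab X (preimage_group H) (unquotient_system \<C>) (\<Union>C)
      = wstab X (preimage_group H) (unquotient_system \<C>) (\<Union>D)"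
    and K: "wstab_candidate \<B> H \<C> C K"
  shows "trivial_on K D"
proof (rule ccontr)
  assume nontrivial: "\<not> trivial_on K D"
  have part: "partition_on \<B> \<C>" by (rule normal_block_system_partition_on(1)[OF H(1,3)])
  then have sub: "\<And>A. A \<in> \<C> \<Longrightarrow> A \<subseteq> \<B>" by (auto simp: partition_on_def)
  then have subX: "\<And>A. A \<in> \<C> \<Longrightarrow> \<Union>A \<subseteq> X" using block_subset by blast
  have KS: "subgroup K (BijGroup \<B>)" and KH: "K \<subseteq> block_fixer H \<C>" and KC: "trivial_on K C"
    and Ktr: "\<And>A. A \<in> \<C> \<Longrightarrow> trivial_on K A \<or> transitive_perm_group A (induced_group K A)"
    using K by (auto simp: wstab_candidate_def)
  have KG: "K \<subseteq> quotient_group G \<B>" using KH H(2) by (auto simp: block_fixer_def)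
  have K0: "K \<noteq> {}" using KC by (simp add: trivial_on_iff)
  define \<T> where "\<T> = {A \<in> \<C>. trivial_on K A}"
  define Y where "Y = \<Union>(\<Union>\<T>)"
  have TC: "\<T> \<subseteq> \<C>" by (auto simp: \<T>_def)
  have fixes_block: "g ` B = B" if g: "g \<in> preimage_group K" and B: "B \<in> \<Union>\<T>" for g B
  proof -
    obtain A where A: "A \<in> \<T>" "B \<in> A" using B by blast
    then have "quotient_perm \<B> g B = B"
      using g by (auto simp: \<T>_def trivial_on_iff preimage_group_def)
    moreover have "B \<in> \<B>" using A TC sub by blast
    ultimately show ?thesis by (simp add: quotient_perm_apply)
  qed
  have block_in_Y: "A \<in> \<T>" if A: "A \<in> \<C>" "B \<in> A" and x: "x \<in> B" "x \<in> Y" for A B x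
  proof -
    obtain A' B' where A': "A' \<in> \<T>" "B' \<in> A'" "x \<in> B'" using x(2) unfolding Y_def by blast
    have "B = B'"
      by (rule partition_on_eqI[OF partition _ _ x(1) A'(3)]) (use A A' TC sub in blast)+
    then have "A = A'"
      using A A' TC by (intro partition_on_eqI[OF part, of A A' B]) auto
    then show ?thesis using A'(1) by simp
  qed
  define \<F> where "\<F> = {E \<in> fixer_block_system X G \<B>. E \<subseteq> Y}"
  \<comment> \<open>A fixer block that meets \<open>Y\<close> lies in the union of a class of \<open>\<equiv>\<close> on \<open>\<C>\<close>, and \<open>K\<close> is a
    candidate for one member of this class, so it is trivial on all of them.\<close>
  have Y: "\<Union>\<F> = Y"
  proof
    show "\<Union>\<F> \<subseteq> Y" by (auto simp: \<F>_def)
    show "Y \<subseteq> \<Union>\<F>"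
    proof
      fix x assume x: "x \<in> Y"
      then have "x \<in> X" using TC subX by (fastforce simp: Y_def)
      then have "x \<in> \<Union>(fixer_block_system X G \<B>)"
        using partition by (simp add: Union_fixer_block_system partition_on_def)
      then obtain E where E: "E \<in> fixer_block_system X G \<B>" "x \<in> E" by blast
      then obtain Q where Q: "Q \<in> fixer_block_system \<B> H \<C>" "E \<subseteq> \<Union>Q"
        using ref by (auto simp: refines_def unquotient_system_def)
      then obtain A0 where A0: "Q = \<Union>{A \<in> \<C>. wstab \<B> H \<C> A0 = wstab \<B> H \<C> A}"
        by (auto simp: fixer_block_system_def)
      have "x \<in> \<Union>Q" using Q(2) E(2) by blast
      then obtain A B where A: "A \<in> \<C>" "wstab \<B> H \<C> A0 = wstab \<B> H \<C> A" "B \<in> A" "x \<in> B"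
        using A0 by auto
      have "A \<in> \<T>" by (rule block_in_Y[OF A(1,3,4) x])
      then have cand: "wstab_candidate \<B> H \<C> A K"
        using K by (simp add: \<T>_def wstab_candidate_def)
      have "A' \<in> \<T>" if A': "A' \<in> \<C>" "wstab \<B> H \<C> A0 = wstab \<B> H \<C> A'" for A'
      proof -
        have "wstab \<B> H \<C> A = wstab \<B> H \<C> A'" using A(2) A'(2) by simp
        then have "wstab_candidate \<B> H \<C> A' K"
          using wstab_eq_iff[OF sub sub, OF A(1) A'(1)] cand by blast
        then show ?thesis using A'(1) by (simp add: \<T>_def wstab_candidate_def)
      qed
      then have "\<Union>Q \<subseteq> Y" unfolding A0 Y_def by blast
      then have "E \<in> \<F>" using E(1) Q(2) by (simp add: \<F>_def)
      then show "x \<in> \<Union>\<F>" using E(2) by blast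
    qed
  qed
  define L where "L = {g \<in> preimage_group K. \<forall>x\<in>Y. g x = x}"
  have lift: "\<exists>l\<in>L. \<forall>x\<in>X - Y. l x = k x" if k: "k \<in> preimage_group K" for k
  proof -
    note GD = subgroup_BijGroupD[OF subgroup]
    have kG: "k \<in> G" using k by (simp add: preimage_group_def)
    define f where "f = perm_restrict X k Y"
    have "perm_restrict X k (\<Union>\<F>) \<in> G"
    proof (rule five_halves_closed_restrict_Union[OF five trans subset_refl normal _ kG])
      show "\<F> \<subseteq> fixer_block_system X G \<B>" by (auto simp: \<F>_def)
      fix B assume B: "B \<in> \<B>" "B \<subseteq> \<Union>\<F>"
      obtain x where x: "x \<in> B" using partition B(1) by (rule partition_on_elem)
      have "B \<in> \<Union>\<C>" using part B(1) by (simp add: partition_on_def)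
      then obtain A where A: "A \<in> \<C>" "B \<in> A" by blast
      have "A \<in> \<T>" using B(2) x Y by (intro block_in_Y[OF A x]) auto
      then show "k ` B = B" using A(2) by (intro fixes_block[OF k]) auto
    qed
    then have f: "f \<in> G" by (simp add: f_def Y)
    obtain h where h: "h \<in> G" "\<And>x. x \<in> X \<Longrightarrow> h (f x) = x" "\<And>x. x \<in> X \<Longrightarrow> f (h x) = x"
      using subgroup_BijGroup_inverse[OF subgroup f] by metis
    \<comment> \<open>\<open>h\<close> is the inverse of the restriction \<open>f\<close> of \<open>k\<close> to \<open>Y\<close>.\<close>
    define l where "l = compose X k h"
    have YX: "Y \<subseteq> X" using TC subX by (auto simp: Y_def)
    have onY: "l x = x" if x: "x \<in> Y" for x
    proof -
      have xX: "x \<in> X" using x YX by blast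
      then have hX: "h x \<in> X" using BijD(1)[of h X] GD(1) h(1) by blast
      have fh: "f (h x) = x" by (rule h(3)[OF xX])
      then have "h x \<in> Y" using x hX by (auto simp: f_def perm_restrict_apply split: if_splits)
      then show ?thesis using fh xX hX by (simp add: l_def compose_def f_def perm_restrict_apply)
    qed
    have offY: "l x = k x" if x: "x \<in> X - Y" for x
    proof -
      have "f x = x" using x by (simp add: f_def perm_restrict_apply)
      then have "h x = x" using h(2)[of x] x by simp
      then show ?thesis using x by (simp add: l_def compose_def)
    qed
    have "quotient_perm \<B> l = quotient_perm \<B> k"
      unfolding quotient_perm_def
    proof (rule restrict_ext)
      fix B assume B: "B \<in> \<B>"
      then have "B \<in> \<Union>\<C>" using part by (simp add: partition_on_def)
      then obtain A where A: "A \<in> \<C>" "B \<in> A" by blast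
      show "l ` B = k ` B"
      proof (cases "A \<in> \<T>")
        case True
        then have "B \<subseteq> Y" using A(2) by (auto simp: Y_def)
        then have "l ` B = B" using onY by (force simp: image_def)
        moreover have "k ` B = B" using A(2) True by (intro fixes_block[OF k]) auto
        ultimately show ?thesis by simp
      next
        case False
        then have "B \<inter> Y = {}" using block_in_Y[OF A] by blast
        then show ?thesis using block_subset[OF B] offY by (intro image_cong) auto
      qed
    qed
    then have "l \<in> preimage_group K"
      using GD(3)[OF kG h(1)] k by (simp add: l_def preimage_group_def)
    then show ?thesis using onY offY by (intro bexI[of _ l]) (auto simp: L_def)
  qed
  have L: "subgroup L (BijGroup X)"
  proof (rule subgroup_BijGroupI[OF fin])
    note PD = subgroup_BijGroupD[OF subgroup_preimage_group[OF KS]]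
    have YX: "Y \<subseteq> X" using TC subX by (auto simp: Y_def)
    show "L \<subseteq> Bij X" using PD(1) by (auto simp: L_def)
    have "\<forall>x\<in>Y. (\<lambda>x\<in>X. x) x = x" using YX by auto
    then show "(\<lambda>x\<in>X. x) \<in> L" unfolding L_def using PD(2) by blast
    fix f g assume fg: "f \<in> L" "g \<in> L"
    then have "compose X f g \<in> preimage_group K" by (intro PD(3)) (auto simp: L_def)
    then show "compose X f g \<in> L" using fg YX by (auto simp: L_def compose_def)
  qed
  have L_fixes: "l ` \<Union>A = \<Union>A" if l: "l \<in> L" and A: "A \<in> \<C>" for l A
  proof -
    have "quotient_perm \<B> l ` A = A"
      using l A KH by (auto simp: L_def preimage_group_def block_fixer_def)
    then show ?thesis using image_Union_blocks[OF sub[OF A]] by simp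
  qed
  have L0: "L \<noteq> {}" using subgroup_BijGroupD(2)[OF L] by blast
  have L_trivial: "trivial_on L (\<Union>A)" if "A \<in> \<T>" for A
    using that L0 by (auto simp: trivial_on_iff L_def Y_def)
  have L_transitive: "transitive_perm_group (\<Union>A) (induced_group L (\<Union>A))"
    if A: "A \<in> \<C>" "A \<notin> \<T>" for A
    unfolding transitive_perm_group_iff
  proof (intro conjI ballI)
    show "finite (\<Union>A)" using fin subX[OF A(1)] finite_subset by blast
    show "subgroup (induced_group L (\<Union>A)) (BijGroup (\<Union>A))"
      by (rule subgroup_induced_group[OF L fin subX[OF A(1)] L_fixes[OF _ A(1)]])
    fix x y assume "x \<in> \<Union>A" "y \<in> \<Union>A"
    then obtain B B' where B: "B \<in> A" "x \<in> B" "B' \<in> A" "y \<in> B'" by blast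
    have "transitive_perm_group A (induced_group K A)" using Ktr[OF A(1)] A by (auto simp: \<T>_def)
    then have "\<exists>k'\<in>induced_group K A. k' B = B'"
      using B(1,3) by (simp add: transitive_perm_group_iff)
    then obtain k' where "k' \<in> induced_group K A" "k' B = B'" by blast
    then obtain k where k: "k \<in> K" "k B = B'" using B(1) by (auto simp: induced_group_def)
    have "B \<in> \<B>" "y \<in> k B" using B sub[OF A(1)] k(2) by auto
    then obtain g where g: "g \<in> preimage_group K" "g x = y"
      using preimage_group_moves[OF KS KG k(1) _ B(2)] by blast
    then obtain l where l: "l \<in> L" "\<forall>x\<in>X - Y. l x = g x" using lift by blast
    have "x \<in> X - Y" using block_in_Y[OF A(1) B(1,2)] A(2) block_subset[OF \<open>B \<in> \<B>\<close>] B(2) by blast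
    then have "restrict l (\<Union>A) x = y" using l(2) g(2) \<open>x \<in> \<Union>A\<close> by simp
    then show "\<exists>l\<in>induced_group L (\<Union>A). l x = y" using l(1) unfolding induced_group_def by blast
  qed
  have "wstab_candidate X (preimage_group H) (unquotient_system \<C>) (\<Union>C) L"
    unfolding wstab_candidate_def
  proof (intro conjI ballI)
    show "subgroup L (BijGroup X)" by (rule L)
    have "L \<subseteq> preimage_group H"
      using KH by (auto simp: L_def preimage_group_def block_fixer_def)
    moreover have "l ` A = A" if lA: "l \<in> L" "A \<in> unquotient_system \<C>" for l A
      using lA(2) L_fixes[OF lA(1)] unfolding unquotient_system_def by blast
    ultimately show "L \<subseteq> block_fixer (preimage_group H) (unquotient_system \<C>)"
      unfolding block_fixer_def by blast
    show "trivial_on L (\<Union>C)" using KC CD(1) by (intro L_trivial) (simp add: \<T>_def)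
    fix A' assume "A' \<in> unquotient_system \<C>"
    then obtain A where A: "A \<in> \<C>" "A' = \<Union>A" by (auto simp: unquotient_system_def)
    show "trivial_on L A' \<or> transitive_perm_group A' (induced_group L A')"
      unfolding A(2) using L_trivial L_transitive[OF A(1)] by blast
  qed
  then have "wstab_candidate X (preimage_group H) (unquotient_system \<C>) (\<Union>D) L"
    using wstab_eq_iff[OF subX subX, OF CD] eq by blast
  then have LD: "l x = x" if "l \<in> L" "x \<in> \<Union>D" for l x
    using that by (auto simp: wstab_candidate_def trivial_on_iff)
  \<comment> \<open>An element of \<open>K\<close> that moves a block in \<open>D\<close> lifts to an element of \<open>L\<close> that moves a point of
    \<open>\<Union>D\<close>.\<close>
  obtain k B where k: "k \<in> K" "B \<in> D" "k B \<noteq> B"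
    using nontrivial K0 by (auto simp: trivial_on_iff)
  have B: "B \<in> \<B>" using k(2) sub[OF CD(2)] by blast
  have "k B \<in> \<B>" using subgroup_BijGroupD(1)[OF KS] k(1) BijD(1)[of k \<B>] B by blast
  then obtain y where y: "y \<in> k B" by (rule partition_on_elem[OF partition])
  obtain x where x: "x \<in> B" "x \<in> X" using partition B by (rule partition_on_elem)
  obtain g where g: "g \<in> preimage_group K" "g x = y"
    using preimage_group_moves[OF KS KG k(1) B x(1) y] by blast
  obtain l where l: "l \<in> L" "\<forall>x\<in>X - Y. l x = g x" using lift[OF g(1)] by blast
  have "D \<notin> \<T>" using nontrivial by (simp add: \<T>_def)
  then have "x \<in> X - Y" using block_in_Y[OF CD(2) k(2) x(1)] x(2) by blast
  then have "l x = y" using l(2) g(2) by simp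
  moreover have "l x = x" using LD[OF l(1)] x(1) k(2) by blast
  ultimately have "x \<in> k B" using y by simp
  then have "k B = B" using partition_on_eqI[OF partition \<open>k B \<in> \<B>\<close> B _ x(1)] by simp
  then show False using k(3) by simp
qed

lemma wstab_eq_quotient:
  assumes five: "five_halves_closed X G"
    and H: "transitive_perm_group \<B> H" "H \<subseteq> quotient_group G \<B>" "normal_block_system \<B> H \<C>"
    and ref: "refines (fixer_block_system X G \<B>) (unquotient_system (fixer_block_system \<B> H \<C>))"
    and CD: "C \<in> \<C>" "D \<in> \<C>"
    and eq: "wstab X (preimage_group H) (unquotient_system \<C>) (\<Union>C)
      = wstab X (preimage_group H) (unquotient_system \<C>) (\<Union>D)"
  shows "wstab \<B> H \<C> C = wstab \<B> H \<C> D"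
proof -
  have "partition_on \<B> \<C>" by (rule normal_block_system_partition_on(1)[OF H(1,3)])
  then have sub: "C \<subseteq> \<B>" "D \<subseteq> \<B>" using CD by (auto simp: partition_on_def)
  note triv = candidate_trivial_on_equivalent_block[OF five H ref]
  have "wstab_candidate \<B> H \<C> D K" if "wstab_candidate \<B> H \<C> C K" for K
    using triv[OF CD eq that] that by (simp add: wstab_candidate_def)
  moreover have "wstab_candidate \<B> H \<C> C K" if "wstab_candidate \<B> H \<C> D K" for K
    using triv[OF CD(2,1) eq[symmetric] that] that by (simp add: wstab_candidate_def)
  ultimately show ?thesis unfolding wstab_eq_iff[OF sub] by blast
qed

text \<open>By the previous lemma, the set \<open>\<Union>F\<close> is a union of blocks \<open>\<F>\<close> of the fixer block system of
  the preimage of \<open>H\<close>.\<close>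

lemma perm_restrict_quotient:
  assumes five: "five_halves_closed X G"
    and H: "transitive_perm_group \<B> H" "H \<subseteq> quotient_group G \<B>" "normal_block_system \<B> H \<C>"
    and ref: "refines (fixer_block_system X G \<B>) (unquotient_system (fixer_block_system \<B> H \<C>))"
    and F: "F \<in> fixer_block_system \<B> H \<C>"
    and g: "g \<in> quotient_group G \<B>" "\<And>C. \<lbrakk>C \<in> \<C>; C \<subseteq> F\<rbrakk> \<Longrightarrow> g ` C = C"
  shows "perm_restrict \<B> g F \<in> quotient_group G \<B>"
proof -
  have part: "partition_on \<B> \<C>" by (rule normal_block_system_partition_on(1)[OF H(1,3)])
  then have sub: "\<And>A. A \<in> \<C> \<Longrightarrow> A \<subseteq> \<B>" by (auto simp: partition_on_def)
  note partX = partition_on_unquotient_system[OF part]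
  let ?P = "preimage_group H" and ?C = "unquotient_system \<C>"
  obtain C0 where F_eq: "F = \<Union>{C \<in> \<C>. wstab \<B> H \<C> C0 = wstab \<B> H \<C> C}"
    and C0: "C0 \<in> \<C>"
    using F by (auto simp: fixer_block_system_def)
  have FB: "F \<subseteq> \<B>" unfolding F_eq using sub by blast
  obtain g' where g': "g' \<in> G" "g = quotient_perm \<B> g'" using g(1) by (auto simp: quotient_group_def)
  define \<F> where "\<F> = {E \<in> fixer_block_system X ?P ?C. E \<subseteq> \<Union>F}"
  have \<F>: "\<Union>\<F> = \<Union>F"
  proof
    show "\<Union>\<F> \<subseteq> \<Union>F" by (auto simp: \<F>_def)
    show "\<Union>F \<subseteq> \<Union>\<F>"
    proof
      fix x assume "x \<in> \<Union>F"
      then obtain C where C: "C \<in> \<C>" "wstab \<B> H \<C> C0 = wstab \<B> H \<C> C" "x \<in> \<Union>C"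
        unfolding F_eq by auto
      define E where "E = \<Union>{A \<in> ?C. wstab X ?P ?C (\<Union>C) = wstab X ?P ?C A}"
      have CC: "\<Union>C \<in> ?C" using C(1) by (auto simp: unquotient_system_def)
      have "A \<subseteq> \<Union>F" if A: "A \<in> ?C" "wstab X ?P ?C (\<Union>C) = wstab X ?P ?C A" for A
      proof -
        obtain D where D: "D \<in> \<C>" "A = \<Union>D" using A(1) by (auto simp: unquotient_system_def)
        have "wstab \<B> H \<C> C = wstab \<B> H \<C> D"
          using A(2) D by (intro wstab_eq_quotient[OF five H ref C(1)]) auto
        then have "D \<subseteq> F" unfolding F_eq using D(1) C(2) by auto
        then show ?thesis using D(2) by blast
      qed
      then have "E \<subseteq> \<Union>F" unfolding E_def by blast
      moreover have "E \<in> fixer_block_system X ?P ?C"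
        unfolding fixer_block_system_def E_def using CC by blast
      moreover have "x \<in> E" unfolding E_def using CC C(3) by blast
      ultimately show "x \<in> \<Union>\<F>" by (auto simp: \<F>_def)
    qed
  qed
  have "perm_restrict X g' (\<Union>\<F>) \<in> G"
  proof (rule five_halves_closed_restrict_Union[OF five _ _ _ _ g'(1)])
    show "transitive_perm_group X ?P" by (rule transitive_perm_group_preimage[OF H(1,2)])
    show "?P \<subseteq> G" by (auto simp: preimage_group_def)
    show "normal_block_system X ?P ?C" by (rule normal_block_system_unquotient[OF H])
    show "\<F> \<subseteq> fixer_block_system X ?P ?C" by (auto simp: \<F>_def)
    fix A assume A: "A \<in> ?C" "A \<subseteq> \<Union>\<F>"
    then obtain C where C: "C \<in> \<C>" "A = \<Union>C" by (auto simp: unquotient_system_def)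
    have "C \<subseteq> F"
    proof
      fix B assume B: "B \<in> C"
      then have "B \<subseteq> \<Union>F" using A(2) C(2) \<F> by blast
      then show "B \<in> F" using block_subset_Union_iff[OF FB] B sub[OF C(1)] by blast
    qed
    then have "g ` C = C" by (rule g(2)[OF C(1)])
    then show "g' ` A = A" unfolding C(2) image_Union_blocks[OF sub[OF C(1)]] g'(2) by simp
  qed
  moreover have "quotient_perm \<B> (perm_restrict X g' (\<Union>\<F>)) = perm_restrict \<B> g F"
    unfolding quotient_perm_def perm_restrict_def[of \<B>]
  proof (rule restrict_ext)
    fix B assume B: "B \<in> \<B>"
    show "perm_restrict X g' (\<Union>\<F>) ` B = (if B \<in> F then g B else B)"
    proof (cases "B \<in> F")
      case True
      then have "perm_restrict X g' (\<Union>\<F>) ` B = g' ` B"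
        unfolding \<F> using block_subset[OF B] by (intro image_cong) (auto simp: perm_restrict_apply)
      then show ?thesis using True B g'(2) by (simp add: quotient_perm_apply)
    next
      case False
      have "x \<notin> \<Union>F" if x: "x \<in> B" for x
      proof
        assume "x \<in> \<Union>F"
        then obtain B' where B': "B' \<in> F" "x \<in> B'" by blast
        then have "B = B'" using FB by (intro partition_on_eqI[OF partition B _ x]) auto
        then show False using False B'(1) by simp
      qed
      then have "perm_restrict X g' (\<Union>\<F>) ` B = (\<lambda>x. x) ` B"
        unfolding \<F> using block_subset[OF B] by (intro image_cong) (auto simp: perm_restrict_apply)
      then show ?thesis using False by simp
    qed
  qed
  ultimately show ?thesis unfolding quotient_group_def by (metis imageI)
qed

end

theorem theorem2p3:
  fixes X :: "'a set" and G :: "('a \<Rightarrow> 'a) set" and \<B> :: "'a set set"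
  assumes "five_halves_closed X G"
    and "normal_block_system X G \<B>"
    and "\<And>H \<C>. \<lbrakk>transitive_perm_group X H; H \<subseteq> G; normal_block_system X H \<C>; refines \<B> \<C>\<rbrakk>
      \<Longrightarrow> refines (fixer_block_system X G \<B>)
            (unquotient_system
              (fixer_block_system \<B> (quotient_group H \<B>) (quotient_system \<C> \<B>)))"
  shows "five_halves_closed \<B> (quotient_group G \<B>)"
proof -
  interpret normal_quotient X G \<B>
    using assms(1,2) by unfold_locales (auto simp: five_halves_closed_def)
  have "perm_restrict \<B> g F \<in> quotient_group G \<B>"
    if H: "transitive_perm_group \<B> H" "H \<subseteq> quotient_group G \<B>" "normal_block_system \<B> H \<C>"
      and F: "F \<in> fixer_block_system \<B> H \<C>" "g \<in> quotient_group G \<B>"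
        "\<forall>C\<in>\<C>. C \<subseteq> F \<longrightarrow> g ` C = C"
    for H \<C> F g
  proof -
    have part: "partition_on \<B> \<C>" by (rule normal_block_system_partition_on(1)[OF H(1,3)])
    have "preimage_group H \<subseteq> G" by (auto simp: preimage_group_def)
    from assms(3)[OF transitive_perm_group_preimage[OF H(1,2)] this
        normal_block_system_unquotient[OF H] refines_unquotient_system[OF part]]
    have "refines (fixer_block_system X G \<B>) (unquotient_system (fixer_block_system \<B> H \<C>))"
      by (simp add: quotient_group_preimage_group[OF H(2)] quotient_unquotient_system[OF part])
    then show ?thesis using F by (intro perm_restrict_quotient[OF assms(1) H]) auto
  qed
  then show ?thesis
    unfolding five_halves_closed_def
    by (intro conjI transitive_perm_group_quotient allI impI) (elim conjE)
qed

end
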